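(* Let $\Delta_n$ be a permissible uniform flag complex on the vertex set $V_n$ such that pairs of arrows of type $THTH$ do not nest. Then the restriction $\Delta_n^+$ of $\Delta_n$ to the set of forward arrows (the subcomplex of faces consisting only of forward arrows) represents a triangulation of the union of those boundary facets of the positive root polytope $P_n^+$ that do not contain the origin.
   Context: Let $e_1,\dots,e_{n+1}$ be the standard basis of $\mathbb{R}^{n+1}$. The root polytope $P_n$ is the convex hull of the points $e_j-e_i$, $i\ne j$; the positive root polytope $P_n^+$ is the convex hull of the origin and the points $e_j-e_i$ with $1\le i<j\le n+1$. An arrow is an ordered pair $(i,j)$, $i\neq j$ in $\{1,\dots,n+1\}$ (tail $i$, head $j$), identified with the point $e_j-e_i$; it is forward if $i<j$ and backward if $i>j$. $V_n$ is the set of arrows. A set of arrows is admissible if contained in $I\times J$ for disjoint $I,J$. A simplicial complex $\Delta_n$ on $V_n$ is permissible if: (i) every face is admissible; (ii) every face is, as an undirected graph, a forest; (iii) for every three distinct $i,j,k$ the sets $\{(i,j),(i,k)\}$ and $\{(j,i),(k,i)\}$ are edges; for any two disjoint pairs $\{i_1,i_2\},\{j_1,j_2\}$ exactly one of $\{(i_1,j_1),(i_2,j_2)\}$, $\{(i_1,j_2),(i_2,j_1)\}$ is an edge; and the 2-skeleton is flag. A flag complex on $V_n$ is uniform if whether a pair $\{(i_1,j_1),(i_2,j_2)\}$ is an edge depends only on the equalities and inequalities among $i_1,i_2,j_1,j_2$. For two arrows with four distinct endpoints $p_1<p_2<p_3<p_4$, the type is the word recording $T$ (tail) or $H$ (head)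 for $p_1,\dots,p_4$ in order; the pair nests if its arrows join $\{p_1,p_4\}$ and $\{p_2,p_3\}$. "Pairs of type $THTH$ do not nest" means no nesting pair of type $THTH$ is an edge. *)

theory Defs
  imports "HOL-Analysis.Analysis"
begin

text \<open>
  The index set \<open>{1,\<dots>,n+1}\<close> is rendered as an arbitrary finite linearly ordered type
  \<open>'n\<close> with \<open>CARD('n) = n + 1\<close>; the ambient space is then \<open>real ^ 'n\<close> and the basis vector
  \<open>e\<^sub>i\<close> is \<open>axis i 1\<close>.  An arrow is the pair (tail, head).
\<close>

type_synonym 'n arrow = "'n \<times> 'n"

definition arrows :: "'n arrow set" where
  "arrows = {(i, j). i \<noteq> j}"

definition forward_arrows :: "('n::linorder) arrow set" where
  "forward_arrows = {(i, j). i < j}"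

definition arrow_point :: "('n::finite) arrow \<Rightarrow> real ^ 'n" where
  "arrow_point a = axis (snd a) 1 - axis (fst a) 1"

definition positive_root_polytope :: "(real ^ 'n::{finite,linorder}) set" where
  "positive_root_polytope = convex hull (insert 0 (arrow_point ` forward_arrows))"


subsection \<open>Abstract simplicial complexes\<close>

text \<open>Every element of \<open>V\<close> is required to be a vertex, and the empty set is a face.\<close>

definition simplicial_complex_on :: "'a set \<Rightarrow> 'a set set \<Rightarrow> bool" where
  "simplicial_complex_on V \<Delta> \<longleftrightarrow>
     (\<forall>\<sigma>\<in>\<Delta>. finite \<sigma> \<and> \<sigma> \<subseteq> V) \<and>
     {} \<in> \<Delta> \<and>
     (\<forall>v\<in>V. {v} \<in> \<Delta>) \<and>
     (\<forall>\<sigma>\<in>\<Delta>. \<forall>\<tau>. \<tau> \<subseteq> \<sigma> \<longrightarrow> \<tau> \<in> \<Delta>)"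

definition flag_on :: "'a set \<Rightarrow> 'a set set \<Rightarrow> bool" where
  "flag_on V \<Delta> \<longleftrightarrow>
     (\<forall>\<sigma>. finite \<sigma> \<and> \<sigma> \<subseteq> V \<and> (\<forall>a\<in>\<sigma>. \<forall>b\<in>\<sigma>. {a, b} \<in> \<Delta>) \<longrightarrow> \<sigma> \<in> \<Delta>)"

text \<open>
  Flagness of the 2-skeleton is a condition on dimensions at most 2 only: three pairwise
  adjacent vertices span a face.  (Requiring the complex of faces of dimension at most 2 to
  be itself a flag complex would forbid four pairwise adjacent vertices, which the other
  conditions below force as soon as \<open>n \<ge> 4\<close>.)
\<close>

definition two_skeleton_flag_on :: "'a set \<Rightarrow> 'a set set \<Rightarrow> bool" where
  "two_skeleton_flag_on V \<Delta> \<longleftrightarrow>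
     (\<forall>\<sigma>. finite \<sigma> \<and> card \<sigma> \<le> 3 \<and> \<sigma> \<subseteq> V \<and> (\<forall>a\<in>\<sigma>. \<forall>b\<in>\<sigma>. {a, b} \<in> \<Delta>) \<longrightarrow> \<sigma> \<in> \<Delta>)"

definition restriction :: "'a set set \<Rightarrow> 'a set \<Rightarrow> 'a set set" where
  "restriction \<Delta> W = {\<sigma> \<in> \<Delta>. \<sigma> \<subseteq> W}"


subsection \<open>Permissible and uniform complexes on the set of arrows\<close>

definition admissible :: "'n arrow set \<Rightarrow> bool" where
  "admissible \<sigma> \<longleftrightarrow> (\<exists>I J. I \<inter> J = {} \<and> \<sigma> \<subseteq> I \<times> J)"

definition adjacent_in :: "'n arrow set \<Rightarrow> 'n \<Rightarrow> 'n \<Rightarrow> bool" where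
  "adjacent_in \<sigma> i j \<longleftrightarrow> (i, j) \<in> \<sigma> \<or> (j, i) \<in> \<sigma>"

text \<open>
  A cycle is given by its cyclic sequence of at least three distinct vertices.  Opposite
  arrows \<open>(i, j)\<close>, \<open>(j, i)\<close> give the same undirected edge here; an admissible set never
  contains both.
\<close>

definition undirected_forest :: "'n arrow set \<Rightarrow> bool" where
  "undirected_forest \<sigma> \<longleftrightarrow>
     \<not> (\<exists>vs. 3 \<le> length vs \<and> distinct vs \<and>
          (\<forall>k<length vs. adjacent_in \<sigma> (vs ! k) (vs ! ((k + 1) mod length vs))))"

definition permissible :: "'n arrow set set \<Rightarrow> bool" where
  "permissible \<Delta> \<longleftrightarrow>
     simplicial_complex_on arrows \<Delta> \<and>
     (\<forall>\<sigma>\<in>\<Delta>. admissible \<sigma>) \<and>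
     (\<forall>\<sigma>\<in>\<Delta>. undirected_forest \<sigma>) \<and>
     (\<forall>i j k. distinct [i, j, k] \<longrightarrow> {(i, j), (i, k)} \<in> \<Delta> \<and> {(j, i), (k, i)} \<in> \<Delta>) \<and>
     (\<forall>i\<^sub>1 i\<^sub>2 j\<^sub>1 j\<^sub>2. i\<^sub>1 \<noteq> i\<^sub>2 \<and> j\<^sub>1 \<noteq> j\<^sub>2 \<and> {i\<^sub>1, i\<^sub>2} \<inter> {j\<^sub>1, j\<^sub>2} = {} \<longrightarrow>
        ({(i\<^sub>1, j\<^sub>1), (i\<^sub>2, j\<^sub>2)} \<in> \<Delta>) \<noteq> ({(i\<^sub>1, j\<^sub>2), (i\<^sub>2, j\<^sub>1)} \<in> \<Delta>)) \<and>
     two_skeleton_flag_on arrows \<Delta>"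

text \<open>
  Two lists satisfy the same equalities and inequalities between entries; in a linear
  order equalities are determined by the strict inequalities.
\<close>

definition same_order_pattern :: "('n::linorder) list \<Rightarrow> 'n list \<Rightarrow> bool" where
  "same_order_pattern xs ys \<longleftrightarrow>
     length xs = length ys \<and>
     (\<forall>k<length xs. \<forall>l<length xs. xs ! k < xs ! l \<longleftrightarrow> ys ! k < ys ! l)"

definition uniform_flag_complex :: "('n::linorder) arrow set set \<Rightarrow> bool" where
  "uniform_flag_complex \<Delta> \<longleftrightarrow>
     simplicial_complex_on arrows \<Delta> \<and>
     flag_on arrows \<Delta> \<and>
     (\<forall>i\<^sub>1 j\<^sub>1 i\<^sub>2 j\<^sub>2 i\<^sub>1' j\<^sub>1' i\<^sub>2' j\<^sub>2'.
        {(i\<^sub>1, j\<^sub>1), (i\<^sub>2, j\<^sub>2), (i\<^sub>1', j\<^sub>1'), (i\<^sub>2', j\<^sub>2')} \<subseteq> arrows \<and>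
        (i\<^sub>1, j\<^sub>1) \<noteq> (i\<^sub>2, j\<^sub>2) \<and> (i\<^sub>1', j\<^sub>1') \<noteq> (i\<^sub>2', j\<^sub>2') \<and>
        same_order_pattern [i\<^sub>1, i\<^sub>2, j\<^sub>1, j\<^sub>2] [i\<^sub>1', i\<^sub>2', j\<^sub>1', j\<^sub>2'] \<longrightarrow>
        ({(i\<^sub>1, j\<^sub>1), (i\<^sub>2, j\<^sub>2)} \<in> \<Delta> \<longleftrightarrow> {(i\<^sub>1', j\<^sub>1'), (i\<^sub>2', j\<^sub>2')} \<in> \<Delta>))"


subsection \<open>Types of pairs of arrows\<close>

datatype endpoint_kind = Tail | Head

definition endpoints :: "'n arrow \<Rightarrow> 'n arrow \<Rightarrow> 'n set" where
  "endpoints a b = {fst a, snd a, fst b, snd b}"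

text \<open>
  The next two notions are meant for pairs of arrows with four distinct endpoints, whose
  increasing enumeration is \<open>sorted_list_of_set (endpoints a b)\<close>.
\<close>

definition pair_type :: "('n::linorder) arrow \<Rightarrow> 'n arrow \<Rightarrow> endpoint_kind list" where
  "pair_type a b =
     map (\<lambda>p. if p \<in> {fst a, fst b} then Tail else Head) (sorted_list_of_set (endpoints a b))"

definition nesting_pair :: "('n::linorder) arrow \<Rightarrow> 'n arrow \<Rightarrow> bool" where
  "nesting_pair a b \<longleftrightarrow>
     (let p = sorted_list_of_set (endpoints a b) in
        {{fst a, snd a}, {fst b, snd b}} = {{p ! 0, p ! 3}, {p ! 1, p ! 2}})"

definition THTH_pairs_do_not_nest :: "('n::linorder) arrow set set \<Rightarrow> bool" where
  "THTH_pairs_do_not_nest \<Delta> \<longleftrightarrow>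
     (\<forall>a\<in>arrows. \<forall>b\<in>arrows.
        card (endpoints a b) = 4 \<and> pair_type a b = [Tail, Head, Tail, Head] \<and> nesting_pair a b
        \<longrightarrow> {a, b} \<notin> \<Delta>)"


subsection \<open>Complexes of arrows representing triangulations\<close>

text \<open>
  The vertex \<open>a\<close> is realised by \<open>arrow_point a\<close> and a face by the convex hull of its
  realised vertices.  Affine independence says that the vertices of each geometric simplex are
  exactly the realised vertices of the face.
\<close>

definition geometric_simplex :: "('n::finite) arrow set \<Rightarrow> (real ^ 'n) set" where
  "geometric_simplex \<sigma> = convex hull (arrow_point ` \<sigma>)"

definition represents_triangulation_of ::
    "('n::finite) arrow set set \<Rightarrow> (real ^ 'n) set \<Rightarrow> bool" where
  "represents_triangulation_of \<Delta> X \<longleftrightarrow>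
     inj_on arrow_point (\<Union>\<Delta>) \<and>
     (\<forall>\<sigma>\<in>\<Delta>. \<not> affine_dependent (arrow_point ` \<sigma>)) \<and>
     simplicial_complex (geometric_simplex ` \<Delta>) \<and>
     (\<Union>\<sigma>\<in>\<Delta>. geometric_simplex \<sigma>) = X"

end

(*
  A forward pair of type THTH is never nested in the complex, so its unnested matching is an edge;
  by uniformity, pairs of type TTHH are either all nesting or all crossing.  The faces of the
  restriction are therefore the alternating sets of forward arrows without crossings, or without
  nestings.  Nonnegative weights on such sets are transport plans from the negative to the
  positive coordinates of their sum x.  The plan of each x in the cone of positive roots exists
  by greedy matching (last-in-first-out or first-in-first-out) and is unique by an exchange
  argument, which gives the simplicial complex.  Its total weight is the sum of the positive
  parts of x, which is at most 1 on the polytope; the facets avoiding the origin cover exactly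
  the points where it equals 1.
*)
theory Submission imports Defs begin

section \<open>Weights on arrows, their flows and coherent sets\<close>

text \<open>Weights live on all ordered pairs, so that weights with different supports can be
  compared directly; a loop contributes the zero vector.\<close>

definition flow :: "('n::finite arrow \<Rightarrow> real) \<Rightarrow> real ^ 'n" where
  "flow f = (\<Sum>a\<in>UNIV. f a *\<^sub>R arrow_point a)"

definition support :: "('a \<Rightarrow> real) \<Rightarrow> 'a set" where
  "support f = {a. f a \<noteq> 0}"

text \<open>For forward arrows: \<open>a\<close> strictly contains \<open>b\<close> if \<open>c\<close> holds, and crosses \<open>b\<close> otherwise.\<close>

definition conflict :: "bool \<Rightarrow> ('n::linorder) arrow \<Rightarrow> 'n arrow \<Rightarrow> bool" where
  "conflict c a b \<longleftrightarrow> fst a < fst b \<and> fst b < snd a \<and> (if c then snd b < snd a else snd a < snd b)"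

text \<open>The inequality of tails and heads is admissibility: no vertex is both a tail and a head.
  Since \<open>a\<close> and \<open>b\<close> range over all ordered pairs, conflicts are excluded
  in both orders.\<close>

definition coherent :: "bool \<Rightarrow> ('n::linorder) arrow set \<Rightarrow> bool" where
  "coherent c \<sigma> \<longleftrightarrow> \<sigma> \<subseteq> forward_arrows \<and>
     (\<forall>a\<in>\<sigma>. \<forall>b\<in>\<sigma>. fst a \<noteq> snd b \<and> \<not> conflict c a b)"

lemma coherent_subset: "coherent c \<sigma> \<Longrightarrow> \<tau> \<subseteq> \<sigma> \<Longrightarrow> coherent c \<tau>"
  unfolding coherent_def by blast

section \<open>Marginals of a weight\<close>

lemma sum_axis: "finite A \<Longrightarrow> (\<Sum>k\<in>A. axis i (1::real) $ k) = of_bool (i \<in> A)"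
  by (simp add: axis_def if_distrib sum.delta cong: if_cong)

lemma sum_arrow_point:
  "(\<Sum>k\<in>A. arrow_point (i, j) $ k) = of_bool (j \<in> A) - of_bool (i \<in> A)"
  by (simp add: arrow_point_def sum_subtractf sum_axis)

lemma flow_nth: "flow f $ k = (\<Sum>i\<in>UNIV. f (i, k)) - (\<Sum>j\<in>UNIV. f (k, j))"
proof -
  have "flow f $ k = (\<Sum>(i, j)\<in>UNIV \<times> UNIV. f (i, j) * (of_bool (j = k) - of_bool (i = k)))"
    by (auto simp: flow_def arrow_point_def axis_def intro!: sum.cong)
  also have "\<dots> = (\<Sum>i\<in>UNIV. \<Sum>j\<in>UNIV. f (i, j) * of_bool (j = k))
      - (\<Sum>i\<in>UNIV. \<Sum>j\<in>UNIV. f (i, j) * of_bool (i = k))"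
    by (simp only: sum.cartesian_product[symmetric] right_diff_distrib sum_subtractf)
  also have "(\<Sum>i\<in>UNIV. \<Sum>j\<in>UNIV. f (i, j) * of_bool (i = k)) =
      (\<Sum>j\<in>UNIV. \<Sum>i\<in>UNIV. f (i, j) * of_bool (i = k))"
    by (rule sum.swap)
  finally show ?thesis by (simp add: of_bool_def if_distrib cong: if_cong)
qed

text \<open>No vertex both receives and emits weight, so one of inflow and outflow at
  \<open>k\<close> vanishes. Their difference, the flow at \<open>k\<close>, then determines
  both.\<close>

lemma alternating_marginals:
  assumes nonneg: "\<And>a. 0 \<le> f a" and alt: "\<And>a b. a \<in> support f \<Longrightarrow> b \<in> support f \<Longrightarrow> fst a \<noteq> snd b"
  shows "(\<Sum>i\<in>UNIV. f (i, k)) = max 0 (flow f $ k)"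
    and "(\<Sum>j\<in>UNIV. f (k, j)) = max 0 (- flow f $ k)"
proof -
  have "(\<forall>i. f (i, k) = 0) \<or> (\<forall>j. f (k, j) = 0)"
    using alt[of "(k, j)" "(i, k)" for i j] by (auto simp: support_def)
  then have "(\<Sum>i\<in>UNIV. f (i, k)) = 0 \<or> (\<Sum>j\<in>UNIV. f (k, j)) = 0"
    by force
  moreover have "(\<Sum>i\<in>UNIV. f (i, k)) \<ge> 0" "(\<Sum>j\<in>UNIV. f (k, j)) \<ge> 0"
    by (auto intro: sum_nonneg nonneg)
  ultimately show "(\<Sum>i\<in>UNIV. f (i, k)) = max 0 (flow f $ k)"
    and "(\<Sum>j\<in>UNIV. f (k, j)) = max 0 (- flow f $ k)"
    by (auto simp: flow_nth)
qed

lemma coherent_marginals: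
  assumes "\<And>a. 0 \<le> f a" "coherent c (support f)"
  shows "(\<Sum>i\<in>UNIV. f (i, k)) = max 0 (flow f $ k)"
    and "(\<Sum>j\<in>UNIV. f (k, j)) = max 0 (- flow f $ k)"
  using alternating_marginals[of f k] assms by (auto simp: coherent_def)

text \<open>Each arrow is counted once, at its head, so the total weight depends on the flow
  alone.\<close>

lemma coherent_sum:
  fixes f :: "'n::{finite,linorder} arrow \<Rightarrow> real"
  assumes "\<And>a. 0 \<le> f a" "coherent c (support f)"
  shows "sum f UNIV = (\<Sum>k\<in>UNIV. max 0 (flow f $ k))"
proof -
  have "sum f UNIV = (\<Sum>i\<in>UNIV. \<Sum>k\<in>UNIV. f (i, k))"
    by (simp add: sum.cartesian_product)
  also have "\<dots> = (\<Sum>k\<in>UNIV. \<Sum>i\<in>UNIV. f (i, k))"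
    by (rule sum.swap)
  finally show ?thesis
    by (simp add: coherent_marginals(1)[OF assms])
qed

section \<open>Uniqueness of the coherent weight with a given flow\<close>

lemma sum_eq_less_imp_greater:
  fixes f g :: "'a \<Rightarrow> real"
  assumes "finite A" "sum f A = sum g A" "i \<in> A" "f i < g i"
  obtains i' where "i' \<in> A" "g i' < f i'"
  using assms sum_strict_mono_ex1[of A f g] by force

text \<open>
  If two weights with equal marginals differ at \<open>(i, j)\<close>, with \<open>j\<close> the first possible head and
  \<open>i\<close> the extreme tail, then the deficient one has arrows \<open>(i', j)\<close> and \<open>(i, j')\<close>, which conflict.
\<close>

lemma coherent_no_exchange:
  fixes f g :: "'n::{finite,linorder} arrow \<Rightarrow> real"
  assumes nonneg: "\<And>a. 0 \<le> f a" "\<And>a. 0 \<le> g a"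
    and coh: "coherent c (support f)" "coherent c (support g)"
    and cols: "(\<Sum>i\<in>UNIV. f (i, j)) = (\<Sum>i\<in>UNIV. g (i, j))"
    and rows: "(\<Sum>j\<in>UNIV. f (i, j)) = (\<Sum>j\<in>UNIV. g (i, j))"
    and less: "g (i, j) < f (i, j)"
    and head: "\<And>i' j'. f (i', j') \<noteq> g (i', j') \<Longrightarrow> j \<le> j'"
    and tail: "\<And>i'. f (i', j) \<noteq> g (i', j) \<Longrightarrow> if c then i \<le> i' else i' \<le> i"
  shows False
proof -
  obtain i' where i': "f (i', j) < g (i', j)"
    using sum_eq_less_imp_greater[OF _ cols[symmetric], of i] less by auto
  obtain j' where j': "f (i, j') < g (i, j')"
    using sum_eq_less_imp_greater[OF _ rows[symmetric], of j] less by auto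
  have "i \<noteq> i'" "j \<noteq> j'" using i' j' less by auto
  have "(i', j) \<in> support g" "(i, j') \<in> support g" "(i, j) \<in> support f"
    using i' j' less nonneg[of "(i', j)"] nonneg[of "(i, j')"] nonneg[of "(i, j)"]
    by (auto simp: support_def)
  moreover from this have "i < j" "i' < j"
    using coh by (auto simp: coherent_def forward_arrows_def)
  moreover have "j < j'" using head[of i j'] j' \<open>j \<noteq> j'\<close> by auto
  moreover have "if c then i < i' else i' < i" using tail[of i'] i' \<open>i \<noteq> i'\<close> by (auto split: if_splits)
  \<comment> \<open>If \<open>c\<close> holds, then \<open>i < i' < j < j'\<close> and
    \<open>(i, j')\<close> contains \<open>(i', j)\<close>. Otherwise \<open>i' < i < j < j'\<close>
    and the two arrows cross.\<close>
  ultimately have "conflict c (i, j') (i', j) \<or> conflict c (i', j) (i, j')"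
    by (auto simp: conflict_def split: if_splits)
  then show False
    using coh(2) \<open>(i', j) \<in> support g\<close> \<open>(i, j') \<in> support g\<close> unfolding coherent_def by blast
qed

text \<open>Equal flows force equal marginals. At an extremal arrow where the weights differ, the
  exchange argument applies to whichever weight is larger there, its hypotheses being symmetric in
  the two.\<close>

lemma coherent_flow_unique:
  fixes f g :: "'n::{finite,linorder} arrow \<Rightarrow> real"
  assumes nonneg: "\<And>a. 0 \<le> f a" "\<And>a. 0 \<le> g a"
    and coh: "coherent c (support f)" "coherent c (support g)"
    and eq: "flow f = flow g"
  shows "f = g"
proof (rule ccontr)
  assume "f \<noteq> g"
  define D where "D = {a. f a \<noteq> g a}"
  have "D \<noteq> {}" using \<open>f \<noteq> g\<close> by (auto simp: D_def)
  define j where "j = Min (snd ` D)"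
  define T where "T = {i. (i, j) \<in> D}"
  have "j \<in> snd ` D" unfolding j_def using \<open>D \<noteq> {}\<close> by (intro Min_in) auto
  then have "T \<noteq> {}" by (auto simp: T_def)
  define i where "i = (if c then Min T else Max T)"
  have "i \<in> T" using \<open>T \<noteq> {}\<close> by (simp add: i_def)
  then have neq: "f (i, j) \<noteq> g (i, j)" by (simp add: T_def D_def)
  have head: "j \<le> j'" if "f (i', j') \<noteq> g (i', j')" for i' j'
    unfolding j_def using that by (intro Min_le) (force simp: D_def)+
  have tail: "if c then i \<le> i' else i' \<le> i" if "f (i', j) \<noteq> g (i', j)" for i'
    using that by (auto simp: i_def T_def D_def)
  have cols: "(\<Sum>i\<in>UNIV. f (i, k)) = (\<Sum>i\<in>UNIV. g (i, k))"
    and rows: "(\<Sum>j\<in>UNIV. f (k, j)) = (\<Sum>j\<in>UNIV. g (k, j))" for k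
    using coherent_marginals[OF nonneg(1) coh(1)] coherent_marginals[OF nonneg(2) coh(2)] eq by auto
  show False
  proof (cases "g (i, j) < f (i, j)")
    case True
    show False
      by (rule coherent_no_exchange[OF nonneg coh cols rows True head tail])
  next
    case False
    with neq have less: "f (i, j) < g (i, j)" by simp
    have "j \<le> j'" if "g (i', j') \<noteq> f (i', j')" for i' j'
      using head[OF that[symmetric]] .
    moreover have "if c then i \<le> i' else i' \<le> i" if "g (i', j) \<noteq> f (i', j)" for i'
      using tail[OF that[symmetric]] .
    ultimately show False
      by (rule coherent_no_exchange[OF nonneg(2,1) coh(2,1) cols[symmetric] rows[symmetric] less])
  qed
qed

section \<open>The cone of forward arrows and greedy matching\<close>

text \<open>The cone generated by the forward arrows, given by inequalities: a forward arrow never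
  carries weight from outside an initial segment into it.\<close>

definition root_cone :: "(real ^ 'n::{finite,linorder}) set" where
  "root_cone = {x. (\<Sum>m\<in>UNIV. x $ m) = 0 \<and> (\<forall>k. (\<Sum>m\<le>k. x $ m) \<le> 0)}"

text \<open>A nonzero vector with coordinate sum zero has a positive entry. Were no entry before the
  first positive one negative, the partial sum up to it would be positive.\<close>

lemma root_cone_first_positive:
  assumes x: "x \<in> root_cone" "x \<noteq> 0"
  obtains j where "x $ j > 0" "\<And>k. k < j \<Longrightarrow> x $ k \<le> 0" "\<exists>i<j. x $ i < 0"
proof -
  have "\<exists>k. x $ k > 0"
  proof (rule ccontr)
    assume "\<not> (\<exists>k. x $ k > 0)"
    then have "\<And>k. - x $ k \<ge> 0" by (simp add: not_less)
    moreover have "(\<Sum>k\<in>UNIV. - x $ k) = 0" using x by (simp add: root_cone_def sum_negf)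
    ultimately have "\<forall>k\<in>UNIV. - x $ k = 0" by (subst (asm) sum_nonneg_eq_0_iff) auto
    with x(2) show False by (auto simp: vec_eq_iff)
  qed
  define j where "j = Min {k. x $ k > 0}"
  have "x $ j > 0" unfolding j_def using \<open>\<exists>k. x $ k > 0\<close> Min_in[of "{k. x $ k > 0}"] by auto
  moreover have le: "x $ k \<le> 0" if "k < j" for k
  proof (rule ccontr)
    assume "\<not> x $ k \<le> 0"
    then have "j \<le> k" unfolding j_def by (intro Min_le) auto
    with that show False by simp
  qed
  moreover have "\<exists>i<j. x $ i < 0"
  proof (rule ccontr)
    assume "\<not> (\<exists>i<j. x $ i < 0)"
    then have "\<And>k. k \<le> j \<Longrightarrow> 0 \<le> x $ k" using \<open>x $ j > 0\<close> by (metis less_eq_real_def not_less order_le_less)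
    then have "x $ j \<le> (\<Sum>m\<le>j. x $ m)" by (intro member_le_sum) auto
    moreover have "(\<Sum>m\<le>j. x $ m) \<le> 0" using x(1) by (simp add: root_cone_def)
    ultimately show False using \<open>x $ j > 0\<close> by simp
  qed
  ultimately show thesis by (rule that)
qed

text \<open>
  The first positive coordinate is matched with a preceding negative one, the first if \<open>c\<close> holds
  and the last otherwise.
\<close>

lemma root_cone_coherent_flow:
  fixes x :: "real ^ 'n::{finite,linorder}"
  assumes "x \<in> root_cone"
  shows "\<exists>f. (\<forall>a. 0 \<le> f a) \<and> coherent c (support f) \<and> flow f = x \<and>
    (\<forall>a\<in>support f. x $ fst a < 0 \<and> 0 < x $ snd a)"
  using assms
proof (induction "card {k. x $ k \<noteq> 0}" arbitrary: x rule: less_induct)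
  case less
  show ?case
  proof (cases "x = 0")
    case True
    then show ?thesis
      by (intro exI[of _ "\<lambda>_. 0"]) (auto simp: support_def coherent_def flow_def)
  next
    case False
    obtain j where j: "x $ j > 0" "\<And>k. k < j \<Longrightarrow> x $ k \<le> 0" "\<exists>i<j. x $ i < 0"
      using root_cone_first_positive[OF less.prems False] by blast
    define T where "T = {i. i < j \<and> x $ i < 0}"
    define i where "i = (if c then Min T else Max T)"
    have T: "T \<noteq> {}" "finite T" using j(3) by (auto simp: T_def)
    then have "i \<in> T" by (simp add: i_def)
    then have i: "i < j" "x $ i < 0" by (auto simp: T_def)
    have i_ext: "if c then i \<le> i' else i' \<le> i" if "i' < j" "x $ i' < 0" for i'
      using that T by (auto simp: i_def T_def)
    \<comment> \<open>The largest amount that \<open>i\<close> can send to \<open>j\<close>. It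
      exhausts one of the two coordinates, so the number of nonzero coordinates drops.\<close>
    define e where "e = min (- x $ i) (x $ j)"
    define y where "y = x - e *\<^sub>R arrow_point (i, j)"
    have e: "e > 0" "e \<le> - x $ i" "e \<le> x $ j" using i j by (auto simp: e_def)
    have y_nth: "y $ k = (if k = i then x $ i + e else if k = j then x $ j - e else x $ k)" for k
      using i by (auto simp: y_def arrow_point_def axis_def)
    have "y $ i = 0 \<or> y $ j = 0" using i by (auto simp: y_nth e_def)
    then have "\<exists>k. y $ k = 0 \<and> x $ k \<noteq> 0" using i(2) j(1) by force
    moreover have "y $ k \<noteq> 0 \<Longrightarrow> x $ k \<noteq> 0" for k
      using i(2) j(1) unfolding y_nth by (cases "k = i"; cases "k = j") simp_all
    ultimately have "{k. y $ k \<noteq> 0} \<subset> {k. x $ k \<noteq> 0}" by blast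
    then have card: "card {k. y $ k \<noteq> 0} < card {k. x $ k \<noteq> 0}"
      by (intro psubset_card_mono) auto
    have y_sum: "(\<Sum>m\<in>A. y $ m) = (\<Sum>m\<in>A. x $ m) - e * (of_bool (j \<in> A) - of_bool (i \<in> A))" for A
      by (simp add: y_def sum_subtractf sum_distrib_left[symmetric] sum_arrow_point)
    have "(\<Sum>m\<le>k. y $ m) \<le> 0" for k
    \<comment> \<open>Only an initial segment separating \<open>i\<close> from \<open>j\<close> has
      its sum changed, by \<open>+ e\<close>. There all entries of \<open>x\<close> are nonpositive,
      so the old sum is at most \<open>x $ i\<close>, hence at most \<open>- e\<close>.\<close>
    proof (cases "i \<le> k \<and> k < j")
      case True
      then have "(\<Sum>m\<le>k. x $ m) = x $ i + (\<Sum>m\<in>{..k} - {i}. x $ m)"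
        by (subst sum.remove[of _ i]) auto
      also have "(\<Sum>m\<in>{..k} - {i}. x $ m) \<le> 0"
        using True by (intro sum_nonpos j(2)) auto
      finally show ?thesis using True e by (simp add: y_sum)
    next
      case False
      then have "(j \<le> k) = (i \<le> k)" using i by auto
      then show ?thesis using less.prems by (simp add: y_sum root_cone_def)
    qed
    then have "y \<in> root_cone" using less.prems by (simp add: root_cone_def y_sum)
    from less.hyps[OF card this] obtain g where g: "\<And>a. 0 \<le> g a" "coherent c (support g)"
      "flow g = y" "\<And>a. a \<in> support g \<Longrightarrow> y $ fst a < 0 \<and> 0 < y $ snd a"
      by blast
    \<comment> \<open>A nonzero coordinate of \<open>y\<close> has the same sign in
      \<open>x\<close>. This is why the sign clause belongs to the inductive claim.\<close>
    have supp: "x $ fst a < 0 \<and> 0 < x $ snd a" if "a \<in> support g" for a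
      using g(4)[OF that] e by (auto simp: y_nth split: if_splits)
    define f where "f = (\<lambda>a. g a + (if a = (i, j) then e else 0))"
    have "flow f = flow g + e *\<^sub>R arrow_point (i, j)"
      by (simp add: flow_def f_def scaleR_left_distrib sum.distrib if_distrib[of "\<lambda>r. r *\<^sub>R _"] cong: if_cong)
    then have flow: "flow f = x" by (simp add: g(3) y_def)
    have sub: "support f \<subseteq> insert (i, j) (support g)" by (auto simp: support_def f_def)
    \<comment> \<open>By the signs, no head of \<open>g\<close> precedes \<open>j\<close>. By the
      choice of \<open>i\<close>, no tail precedes \<open>i\<close> if \<open>c\<close> holds, and
      none lies strictly between \<open>i\<close> and \<open>j\<close> otherwise. Each possible
      conflict with \<open>(i, j)\<close> needs one of these.\<close>
    have new: "fst a \<noteq> j \<and> snd a \<noteq> i \<and> \<not> conflict c a (i, j) \<and> \<not> conflict c (i, j) a"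
      if "a \<in> support g" for a
    proof -
      have a: "x $ fst a < 0" "0 < x $ snd a" using supp[OF that] by auto
      have "j \<le> snd a" using a(2) j(2)[of "snd a"] by force
      moreover have "if c then i \<le> fst a else fst a \<le> i \<or> j \<le> fst a"
        using i_ext[of "fst a"] a(1) i(1) by (cases "fst a < j") auto
      moreover have "fst a \<noteq> j" "snd a \<noteq> i" using a i(2) j(1) by auto
      ultimately show ?thesis by (auto simp: conflict_def)
    qed
    have "coherent c (insert (i, j) (support g))"
      unfolding coherent_def
    proof (intro conjI ballI)
      show "insert (i, j) (support g) \<subseteq> forward_arrows"
        using g(2) i(1) by (simp add: coherent_def forward_arrows_def)
    next
      fix a b assume "a \<in> insert (i, j) (support g)" "b \<in> insert (i, j) (support g)"
      then consider "a = (i, j)" "b = (i, j)" | "a = (i, j)" "b \<in> support g"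
        | "a \<in> support g" "b = (i, j)" | "a \<in> support g" "b \<in> support g" by blast
      then have "fst a \<noteq> snd b \<and> \<not> conflict c a b"
      proof cases
        case 1 then show ?thesis using i(1) by (simp add: conflict_def)
      next
        case 2 then show ?thesis using new[of b] by (metis fst_conv)
      next
        case 3 then show ?thesis using new[of a] by simp
      next
        case 4 then show ?thesis using g(2) by (simp add: coherent_def)
      qed
      then show "fst a \<noteq> snd b" "\<not> conflict c a b" by blast+
    qed
    then have "coherent c (support f)" using sub coherent_subset by blast
    moreover have "\<forall>a. 0 \<le> f a" using g(1) e(1) by (simp add: f_def)
    moreover have "\<forall>a\<in>support f. x $ fst a < 0 \<and> 0 < x $ snd a" using sub supp i j(1) by force
    ultimately show ?thesis using flow by blast
  qed
qed

section \<open>Geometric simplices of coherent sets\<close>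

lemma arrow_point_nth:
  assumes "a \<in> arrows"
  shows "arrow_point a $ k = 1 \<longleftrightarrow> k = snd a" "arrow_point a $ k = - 1 \<longleftrightarrow> k = fst a"
  using assms by (auto simp: arrow_point_def axis_def arrows_def)

lemma inj_on_arrow_point: "inj_on arrow_point (arrows :: 'n::finite arrow set)"
proof (rule inj_onI)
  fix a b :: "'n arrow" assume "a \<in> arrows" "b \<in> arrows" "arrow_point a = arrow_point b"
  then have "snd a = snd b" "fst a = fst b"
    using arrow_point_nth[of a "snd a"] arrow_point_nth[of b "snd a"]
      arrow_point_nth[of a "fst a"] arrow_point_nth[of b "fst a"] by auto
  then show "a = b" by (rule prod_eqI[rotated])
qed

lemma forward_arrows_subset: "forward_arrows \<subseteq> arrows"
  by (auto simp: forward_arrows_def arrows_def)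

lemma flow_eq_sum: "support f \<subseteq> \<sigma> \<Longrightarrow> flow f = (\<Sum>a\<in>\<sigma>. f a *\<^sub>R arrow_point a)"
  unfolding flow_def by (rule sum.mono_neutral_right) (auto simp: support_def)

text \<open>Injectivity of \<open>arrow_point\<close> moves convex coefficients from points to
  arrows; extension by zero makes them weights, to which the uniqueness of coherent weights
  applies.\<close>

lemma geometric_simplex_iff:
  fixes \<sigma> :: "'n::finite arrow set"
  assumes "\<sigma> \<subseteq> arrows"
  shows "x \<in> geometric_simplex \<sigma> \<longleftrightarrow>
    (\<exists>f. (\<forall>a. 0 \<le> f a) \<and> support f \<subseteq> \<sigma> \<and> sum f UNIV = 1 \<and> flow f = x)"
proof
  have inj: "inj_on arrow_point \<sigma>" using inj_on_arrow_point assms by (rule inj_on_subset)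
  assume "x \<in> geometric_simplex \<sigma>"
  then obtain u where u: "\<forall>y\<in>arrow_point ` \<sigma>. 0 \<le> u y" "sum u (arrow_point ` \<sigma>) = 1"
    "(\<Sum>y\<in>arrow_point ` \<sigma>. u y *\<^sub>R y) = x"
    by (auto simp: geometric_simplex_def convex_hull_finite)
  define f where "f = (\<lambda>a. if a \<in> \<sigma> then u (arrow_point a) else 0)"
  have supp: "support f \<subseteq> \<sigma>" by (auto simp: support_def f_def)
  have "flow f = x"
    using u(3) by (subst flow_eq_sum[OF supp]) (simp add: f_def sum.reindex[OF inj])
  moreover have "sum f UNIV = 1" using u(2) by (simp add: f_def sum.reindex[OF inj] sum.If_cases)
  moreover have "\<forall>a. 0 \<le> f a" using u(1) by (simp add: f_def)
  ultimately show "\<exists>f. (\<forall>a. 0 \<le> f a) \<and> support f \<subseteq> \<sigma> \<and> sum f UNIV = 1 \<and> flow f = x"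
    using supp by blast
next
  assume "\<exists>f. (\<forall>a. 0 \<le> f a) \<and> support f \<subseteq> \<sigma> \<and> sum f UNIV = 1 \<and> flow f = x"
  then obtain f where f: "\<forall>a. 0 \<le> f a" "support f \<subseteq> \<sigma>" "sum f UNIV = 1" "flow f = x"
    by blast
  have "sum f \<sigma> = sum f UNIV"
    using f(2) by (intro sum.mono_neutral_left) (auto simp: support_def)
  with f(1,3) have "(\<Sum>a\<in>\<sigma>. f a *\<^sub>R arrow_point a) \<in> convex hull (arrow_point ` \<sigma>)"
    by (intro convex_sum) (auto intro: hull_inc)
  then show "x \<in> geometric_simplex \<sigma>"
    using f(4) by (simp add: geometric_simplex_def flow_eq_sum[OF f(2)])
qed

lemma coherent_subset_arrows: "coherent c \<sigma> \<Longrightarrow> \<sigma> \<subseteq> arrows"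
  using forward_arrows_subset unfolding coherent_def by blast

text \<open>
  A linear relation among the points of a coherent set, added to a large constant weight,
  would give a second nonnegative weight with the same flow.
\<close>

lemma coherent_independent:
  fixes \<sigma> :: "'n::{finite,linorder} arrow set"
  assumes "coherent c \<sigma>"
  shows "independent (arrow_point ` \<sigma>)"
proof
  have inj: "inj_on arrow_point \<sigma>"
    using inj_on_arrow_point coherent_subset_arrows[OF assms] by (rule inj_on_subset)
  assume "dependent (arrow_point ` \<sigma>)"
  then obtain u b where b: "b \<in> \<sigma>" "u (arrow_point b) \<noteq> 0"
    and u: "(\<Sum>y\<in>arrow_point ` \<sigma>. u y *\<^sub>R y) = 0"
    by (auto simp: dependent_finite)
  define K where "K = (\<Sum>a\<in>\<sigma>. \<bar>u (arrow_point a)\<bar>)"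
  define f where "f = (\<lambda>a. if a \<in> \<sigma> then K + u (arrow_point a) else 0)"
  define g where "g = (\<lambda>a. if a \<in> \<sigma> then K else 0)"
  have K: "\<bar>u (arrow_point a)\<bar> \<le> K" if "a \<in> \<sigma>" for a
    unfolding K_def using that by (intro member_le_sum) auto
  have supp: "support f \<subseteq> \<sigma>" "support g \<subseteq> \<sigma>" by (auto simp: support_def f_def g_def)
  have "f = g"
  proof (rule coherent_flow_unique)
    show "0 \<le> f a" "0 \<le> g a" for a
      using K[of a] by (auto simp: f_def g_def)
    show "coherent c (support f)" "coherent c (support g)"
      using supp assms coherent_subset by blast+
    show "flow f = flow g"
      using u unfolding flow_eq_sum[OF supp(1)] flow_eq_sum[OF supp(2)]
      by (simp add: f_def g_def scaleR_left_distrib sum.distrib sum.reindex[OF inj])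
  qed
  then have "f b = g b" by simp
  with b show False by (simp add: f_def g_def)
qed

lemma coherent_affine_independent:
  fixes \<sigma> :: "'n::{finite,linorder} arrow set"
  shows "coherent c \<sigma> \<Longrightarrow> \<not> affine_dependent (arrow_point ` \<sigma>)"
  using coherent_independent affine_dependent_imp_dependent by blast

text \<open>A common point has a weight supported in \<open>\<sigma>\<close> and one supported in
  \<open>\<tau>\<close>. By uniqueness they coincide, so the support lies in both.\<close>

lemma geometric_simplex_Int:
  fixes \<sigma> \<tau> :: "'n::{finite,linorder} arrow set"
  assumes \<sigma>: "coherent c \<sigma>" and \<tau>: "coherent c \<tau>"
  shows "geometric_simplex \<sigma> \<inter> geometric_simplex \<tau> = geometric_simplex (\<sigma> \<inter> \<tau>)"
proof
  show "geometric_simplex (\<sigma> \<inter> \<tau>) \<subseteq> geometric_simplex \<sigma> \<inter> geometric_simplex \<tau>"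
    unfolding geometric_simplex_def by (intro Int_greatest hull_mono image_mono) auto
next
  have sub: "\<sigma> \<subseteq> arrows" "\<tau> \<subseteq> arrows" "\<sigma> \<inter> \<tau> \<subseteq> arrows"
    using assms coherent_subset_arrows by blast+
  show "geometric_simplex \<sigma> \<inter> geometric_simplex \<tau> \<subseteq> geometric_simplex (\<sigma> \<inter> \<tau>)"
  proof
    fix x assume "x \<in> geometric_simplex \<sigma> \<inter> geometric_simplex \<tau>"
    then obtain f g where f: "\<forall>a. 0 \<le> f a" "support f \<subseteq> \<sigma>" "sum f UNIV = 1" "flow f = x"
      and g: "\<forall>a. 0 \<le> g a" "support g \<subseteq> \<tau>" "flow g = x"
      unfolding Int_iff geometric_simplex_iff[OF sub(1)] geometric_simplex_iff[OF sub(2)] by blast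
    have "f = g"
      by (rule coherent_flow_unique)
        (use f g coherent_subset[OF \<sigma> f(2)] coherent_subset[OF \<tau> g(2)] in auto)
    with f g show "x \<in> geometric_simplex (\<sigma> \<inter> \<tau>)"
      unfolding geometric_simplex_iff[OF sub(3)] by blast
  qed
qed

text \<open>By affine independence the faces of a simplex are spanned by subsets of its vertices,
  and coherence passes to subsets.\<close>

lemma coherent_simplicial_complex:
  "simplicial_complex (geometric_simplex ` {\<sigma> :: 'n::{finite,linorder} arrow set. coherent c \<sigma>})"
proof -
  have faces: "F face_of geometric_simplex \<sigma> \<longleftrightarrow> (\<exists>\<tau>\<subseteq>\<sigma>. F = geometric_simplex \<tau>)"
    if "coherent c \<sigma>" for F and \<sigma> :: "'n arrow set"
    unfolding geometric_simplex_def face_of_convex_hull_affine_independent[OF coherent_affine_independent[OF that]]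
    by (auto simp: subset_image_iff)
  show ?thesis
    unfolding simplicial_complex_def
  proof (intro conjI ballI allI impI)
    fix S assume "S \<in> geometric_simplex ` {\<sigma> :: 'n arrow set. coherent c \<sigma>}"
    then obtain \<sigma> where "coherent c \<sigma>" "S = geometric_simplex \<sigma>" by blast
    \<comment> \<open>The dimension is an integer, being -1 for the empty face.\<close>
    then have "(int (card (arrow_point ` \<sigma>)) - 1) simplex S"
      unfolding simplex_def geometric_simplex_def using coherent_affine_independent by auto
    then show "\<exists>n. n simplex S" ..
  next
    fix F S assume "S \<in> geometric_simplex ` {\<sigma> :: 'n arrow set. coherent c \<sigma>} \<and> F face_of S"
    then obtain \<sigma> where \<sigma>: "coherent c \<sigma>" "F face_of geometric_simplex \<sigma>" by blast
    then obtain \<tau> where "\<tau> \<subseteq> \<sigma>" "F = geometric_simplex \<tau>" using faces by metis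
    then show "F \<in> geometric_simplex ` {\<sigma>. coherent c \<sigma>}"
      using coherent_subset[OF \<sigma>(1)] by simp
  next
    fix S S' assume "S \<in> geometric_simplex ` {\<sigma> :: 'n arrow set. coherent c \<sigma>} \<and>
      S' \<in> geometric_simplex ` {\<tau> :: 'n arrow set. coherent c \<tau>}"
    then obtain \<sigma> \<tau> where "coherent c \<sigma>" "S = geometric_simplex \<sigma>"
      "coherent c \<tau>" "S' = geometric_simplex \<tau>" by blast
    then show "S \<inter> S' face_of S"
      by (auto simp: geometric_simplex_Int faces)
  qed auto
qed

section \<open>The positive root polytope and its facets avoiding the origin\<close>

text \<open>Both conditions define convex sets, the sum of positive parts being a convex function
  with value 0 at the origin and 1 at each forward arrow.\<close>

lemma positive_root_polytope_bounds:
  fixes x :: "real ^ 'n::{finite,linorder}"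
  assumes "x \<in> positive_root_polytope"
  shows "x \<in> root_cone" "(\<Sum>k\<in>UNIV. max 0 (x $ k)) \<le> 1"
proof -
  define K :: "(real, 'n) vec set" where "K = {x \<in> root_cone. (\<Sum>k\<in>UNIV. max 0 (x $ k)) \<le> 1}"
  have "convex K"
  proof (rule convexI)
    fix x y :: "(real, 'n) vec" and u v :: real
    assume x: "x \<in> K" and y: "y \<in> K" and uv: "0 \<le> u" "0 \<le> v" "u + v = 1"
    have sum: "(\<Sum>m\<in>A. (u *\<^sub>R x + v *\<^sub>R y) $ m) = u * (\<Sum>m\<in>A. x $ m) + v * (\<Sum>m\<in>A. y $ m)" for A
      by (simp add: sum.distrib sum_distrib_left)
    have "u * (\<Sum>m\<le>k. x $ m) + v * (\<Sum>m\<le>k. y $ m) \<le> 0" for k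
      using x y uv by (intro add_nonpos_nonpos mult_nonneg_nonpos) (auto simp: K_def root_cone_def)
    then have "u *\<^sub>R x + v *\<^sub>R y \<in> root_cone"
      using x y unfolding root_cone_def mem_Collect_eq sum by (simp add: K_def root_cone_def)
    moreover have "(\<Sum>k\<in>UNIV. max 0 ((u *\<^sub>R x + v *\<^sub>R y) $ k)) \<le> 1"
    proof -
      have "max 0 ((u *\<^sub>R x + v *\<^sub>R y) $ k) \<le> u * max 0 (x $ k) + v * max 0 (y $ k)" for k
        using uv by (auto intro!: add_mono mult_left_mono)
      then have "(\<Sum>k\<in>UNIV. max 0 ((u *\<^sub>R x + v *\<^sub>R y) $ k))
          \<le> u * (\<Sum>k\<in>UNIV. max 0 (x $ k)) + v * (\<Sum>k\<in>UNIV. max 0 (y $ k))"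
        by (simp add: sum_mono sum_distrib_left flip: sum.distrib)
      also have "\<dots> \<le> u * 1 + v * 1"
        using x y uv by (intro add_mono mult_left_mono) (auto simp: K_def)
      finally show ?thesis using uv by simp
    qed
    ultimately show "u *\<^sub>R x + v *\<^sub>R y \<in> K" by (simp add: K_def)
  qed
  moreover have "insert 0 (arrow_point ` forward_arrows) \<subseteq> K"
  proof -
    have "arrow_point (i, j) \<in> K" if "i < j" for i j :: 'n
    proof -
      have "(\<Sum>k\<in>UNIV. max 0 (arrow_point (i, j) $ k)) = (\<Sum>k\<in>UNIV. axis j 1 $ k)"
        using that by (intro sum.cong) (auto simp: arrow_point_def axis_def)
      then show ?thesis
        using that by (auto simp: K_def root_cone_def sum_arrow_point sum_axis)
    qed
    then show ?thesis by (auto simp: forward_arrows_def K_def root_cone_def)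
  qed
  ultimately have "positive_root_polytope \<subseteq> K"
    unfolding positive_root_polytope_def by (rule hull_minimal[rotated])
  with assms show "x \<in> root_cone" "(\<Sum>k\<in>UNIV. max 0 (x $ k)) \<le> 1" by (auto simp: K_def)
qed

lemma geometric_simplex_subset_polytope:
  "\<sigma> \<subseteq> forward_arrows \<Longrightarrow> geometric_simplex \<sigma> \<subseteq> positive_root_polytope"
  unfolding geometric_simplex_def positive_root_polytope_def by (intro hull_mono) auto

lemma zero_in_positive_root_polytope: "0 \<in> positive_root_polytope"
  by (simp add: positive_root_polytope_def hull_inc)

lemma positive_root_polytope_facet_through:
  fixes x :: "real ^ 'n::{finite,linorder}"
  assumes x: "x \<in> positive_root_polytope" and one: "(\<Sum>k\<in>UNIV. max 0 (x $ k)) = 1"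
  obtains F where "F facet_of positive_root_polytope" "0 \<notin> F" "x \<in> F"
proof -
  let ?P = "positive_root_polytope :: (real, 'n) vec set"
  \<comment> \<open>This linear functional is bounded above by the sum of positive parts and agrees
    with it at \<open>x\<close>. So its value 1 gives a hyperplane that supports the polytope,
    contains \<open>x\<close> and misses the origin.\<close>
  define h :: "(real, 'n) vec" where "h = (\<chi> k. of_bool (x $ k > 0))"
  have h: "h \<bullet> y = (\<Sum>k\<in>UNIV. of_bool (x $ k > 0) * y $ k)" for y
    by (simp add: inner_vec_def h_def)
  have "h \<bullet> y \<le> 1" if "y \<in> ?P" for y
  proof -
    have "h \<bullet> y \<le> (\<Sum>k\<in>UNIV. max 0 (y $ k))" unfolding h by (rule sum_mono) auto
    with positive_root_polytope_bounds(2)[OF that] show ?thesis by simp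
  qed
  then have face: "?P \<inter> {y. h \<bullet> y = 1} face_of ?P"
    by (intro face_of_Int_supporting_hyperplane_le) (simp_all add: positive_root_polytope_def)
  have "h \<bullet> x = (\<Sum>k\<in>UNIV. max 0 (x $ k))" unfolding h by (rule sum.cong) auto
  then have x_in: "x \<in> ?P \<inter> {y. h \<bullet> y = 1}" using x one by simp
  have proper: "?P \<inter> {y. h \<bullet> y = 1} \<noteq> ?P" using zero_in_positive_root_polytope by force
  \<comment> \<open>A nonempty proper face of a polyhedron is the intersection of the facets
    containing it. As the origin is not in the face, one of these facets misses it.\<close>
  have "polyhedron ?P" unfolding positive_root_polytope_def by (intro polyhedron_convex_hull) simp
  from face_of_polyhedron[OF this face _ proper] x_in
  have "?P \<inter> {y. h \<bullet> y = 1} = \<Inter>{F. F facet_of ?P \<and> ?P \<inter> {y. h \<bullet> y = 1} \<subseteq> F}" by blast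
  moreover have "0 \<notin> ?P \<inter> {y. h \<bullet> y = 1}" by simp
  ultimately obtain F where "F facet_of ?P" "?P \<inter> {y. h \<bullet> y = 1} \<subseteq> F" "0 \<notin> F"
    by blast
  with x_in show thesis by (intro that) auto
qed

text \<open>Both sides consist of the points of the polytope whose positive parts sum to 1, which is
  the total weight of their coherent representation.\<close>

lemma coherent_simplices_cover:
  "(\<Union>\<sigma>\<in>{\<sigma>. coherent c \<sigma>}. geometric_simplex \<sigma>) =
    \<Union>{F :: (real ^ 'n::{finite,linorder}) set. F facet_of positive_root_polytope \<and> 0 \<notin> F}"
proof (intro equalityI subsetI)
  fix x :: "(real, 'n) vec" assume "x \<in> (\<Union>\<sigma>\<in>{\<sigma>. coherent c \<sigma>}. geometric_simplex \<sigma>)"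
  then obtain \<sigma> where \<sigma>: "coherent c \<sigma>" "x \<in> geometric_simplex \<sigma>" by blast
  then obtain f where f: "\<forall>a. 0 \<le> f a" "support f \<subseteq> \<sigma>" "sum f UNIV = 1" "flow f = x"
    using geometric_simplex_iff[OF coherent_subset_arrows[OF \<sigma>(1)]] by blast
  have "(\<Sum>k\<in>UNIV. max 0 (x $ k)) = 1"
    using coherent_sum[of f c] f coherent_subset[OF \<sigma>(1) f(2)] by simp
  moreover have "x \<in> positive_root_polytope"
    using \<sigma> geometric_simplex_subset_polytope unfolding coherent_def by blast
  ultimately show "x \<in> \<Union>{F. F facet_of positive_root_polytope \<and> 0 \<notin> F}"
    using positive_root_polytope_facet_through by blast
next
  fix x :: "(real, 'n) vec"
  assume "x \<in> \<Union>{F. F facet_of positive_root_polytope \<and> 0 \<notin> F}"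
  then obtain F where F: "F facet_of positive_root_polytope" "0 \<notin> F" "x \<in> F" by blast
  have face: "F face_of positive_root_polytope" using F(1) by (rule facet_of_imp_face_of)
  then have x: "x \<in> positive_root_polytope" using F(3) face_of_imp_subset by blast
  obtain f where f: "\<forall>a. 0 \<le> f a" "coherent c (support f)" "flow f = x"
    using root_cone_coherent_flow[OF positive_root_polytope_bounds(1)[OF x]] by blast
  define s where "s = sum f UNIV"
  have "s \<le> 1"
    using positive_root_polytope_bounds(2)[OF x] coherent_sum[of f c] f by (simp add: s_def)
  \<comment> \<open>Dividing by the total weight turns the coherent weight of \<open>x\<close> into
    a convex combination.\<close>
  have in_scaled: "(1 / s) *\<^sub>R x \<in> geometric_simplex (support f)" if "s > 0"
  proof -
    have "support (\<lambda>a. f a / s) \<subseteq> support f" by (auto simp: support_def)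
    moreover have "sum (\<lambda>a. f a / s) UNIV = 1" using that by (simp add: s_def flip: sum_divide_distrib)
    moreover have "flow (\<lambda>a. f a / s) = (1 / s) *\<^sub>R x"
      by (simp add: flow_def scaleR_sum_right flip: f(3))
    ultimately show ?thesis
      using f(1) that unfolding geometric_simplex_iff[OF coherent_subset_arrows[OF f(2)]]
      by (intro exI[of _ "\<lambda>a. f a / s"]) auto
  qed
  have "s > 0"
  proof (rule ccontr)
    assume "\<not> s > 0"
    then have "s = 0" using f(1) sum_nonneg[of UNIV f] by (force simp: s_def)
    then have "f a = 0" for a using f(1) by (cases a) (simp add: s_def sum_nonneg_eq_0_iff)
    then have "x = 0" by (simp add: flow_def flip: f(3))
    with F show False by simp
  qed
  have "s = 1"
  proof (rule ccontr)
    assume "s \<noteq> 1"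
    with \<open>s \<le> 1\<close> have "s < 1" by simp
    have "(1 / s) *\<^sub>R x \<in> positive_root_polytope"
      using in_scaled[OF \<open>s > 0\<close>] geometric_simplex_subset_polytope f(2) unfolding coherent_def by blast
    \<comment> \<open>With \<open>s < 1\<close> the point \<open>x\<close> would lie strictly
      between two points of the polytope, the origin being one of them. A face containing
      \<open>x\<close> then contains both ends.\<close>
    moreover have "x \<in> open_segment 0 ((1 / s) *\<^sub>R x)"
      using \<open>s > 0\<close> \<open>s < 1\<close> F by (auto simp: in_segment intro!: exI[of _ s])
    ultimately have "0 \<in> F"
      using face F(3) zero_in_positive_root_polytope unfolding face_of_def by blast
    with F(2) show False by simp
  qed
  with in_scaled f(2) show "x \<in> (\<Union>\<sigma>\<in>{\<sigma>. coherent c \<sigma>}. geometric_simplex \<sigma>)" by auto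
qed

section \<open>Forward faces of the complex are the coherent sets\<close>

lemma sorted_list_of_set_four:
  fixes p q r s :: "'n::{finite,linorder}"
  assumes "p < q" "q < r" "r < s"
  shows "sorted_list_of_set {p, q, r, s} = [p, q, r, s]"
proof -
  have "sorted_list_of_set (set [p, q, r, s]) = [p, q, r, s]"
    by (rule sorted_list_of_set.idem_if_sorted_distinct) (use assms in auto)
  then show ?thesis by (simp only: list.set)
qed

text \<open>The tails \<open>p\<close>, \<open>r\<close> and heads \<open>q\<close>,
  \<open>s\<close> have two matchings, exactly one of which is an edge. The other one, with the
  backward arrow \<open>(r, q)\<close>, is a nesting pair of type THTH and so is excluded.\<close>

lemma THTH_edge:
  fixes \<Delta> :: "'n::{finite,linorder} arrow set set"
  assumes perm: "permissible \<Delta>" and THTH: "THTH_pairs_do_not_nest \<Delta>"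
    and less: "p < q" "q < r" "r < s"
  shows "{(p, q), (r, s)} \<in> \<Delta>"
proof -
  have ends: "endpoints (p, s) (r, q) = {p, q, r, s}" by (auto simp: endpoints_def)
  moreover have "card {p, q, r, s} = 4" using less by (auto simp: card_insert_if)
  moreover have "pair_type (p, s) (r, q) = [Tail, Head, Tail, Head]"
    unfolding pair_type_def ends sorted_list_of_set_four[OF less] using less by auto
  moreover have "nesting_pair (p, s) (r, q)"
    unfolding nesting_pair_def ends sorted_list_of_set_four[OF less] by (auto simp: Let_def)
  moreover have "(p, s) \<in> arrows" "(r, q) \<in> arrows" using less by (auto simp: arrows_def)
  ultimately have "{(p, s), (r, q)} \<notin> \<Delta>"
    using THTH unfolding THTH_pairs_do_not_nest_def by metis
  moreover have "p \<noteq> r" "q \<noteq> s" "{p, r} \<inter> {q, s} = {}" using less by auto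
  ultimately show ?thesis using perm unfolding permissible_def by metis
qed

text \<open>On any four points exactly one of nesting and crossing is an edge, and uniformity
  carries the choice from one quadruple to every other.\<close>

lemma TTHH_edges:
  fixes \<Delta> :: "'n::{finite,linorder} arrow set set"
  assumes perm: "permissible \<Delta>" and uni: "uniform_flag_complex \<Delta>"
  obtains c where "\<And>p q r s. p < q \<Longrightarrow> q < r \<Longrightarrow> r < s \<Longrightarrow>
    ({(p, s), (q, r)} \<in> \<Delta> \<longleftrightarrow> \<not> c) \<and> ({(p, r), (q, s)} \<in> \<Delta> \<longleftrightarrow> c)"
proof -
  have one: "({(p, s), (q, r)} \<in> \<Delta>) \<noteq> ({(p, r), (q, s)} \<in> \<Delta>)"
    if "p < q" "q < r" "r < s" for p q r s
  proof -
    have "p \<noteq> q" "s \<noteq> r" "{p, q} \<inter> {s, r} = {}" using that by auto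
    then show ?thesis using perm unfolding permissible_def by metis
  qed
  have same: "{(p, s), (q, r)} \<in> \<Delta> \<longleftrightarrow> {(p', s'), (q', r')} \<in> \<Delta>"
    if "p < q" "q < r" "r < s" "p' < q'" "q' < r'" "r' < s'" for p q r s p' q' r' s'
  proof -
    have "same_order_pattern [p, q, s, r] [p', q', s', r']"
      using that by (auto simp: same_order_pattern_def All_less_Suc)
    moreover have "{(p, s), (q, r), (p', s'), (q', r')} \<subseteq> arrows" "(p, s) \<noteq> (q, r)" "(p', s') \<noteq> (q', r')"
      using that by (auto simp: arrows_def)
    ultimately show ?thesis using uni unfolding uniform_flag_complex_def by blast
  qed
  \<comment> \<open>\<open>c\<close> records that crossings are the edges, so that nestings are the
    conflicts. With fewer than four points it is false and the claim is vacuous.\<close>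
  define c where "c \<longleftrightarrow> (\<exists>p q r s. p < q \<and> q < r \<and> r < s \<and> {(p, r), (q, s)} \<in> \<Delta>)"
  show thesis
  proof (rule that[of c])
    fix p q r s :: 'n assume "p < q" "q < r" "r < s"
    then show "({(p, s), (q, r)} \<in> \<Delta> \<longleftrightarrow> \<not> c) \<and> ({(p, r), (q, s)} \<in> \<Delta> \<longleftrightarrow> c)"
      unfolding c_def using one same by meson
  qed
qed

text \<open>Coherence is a condition on pairs, and flagness reduces faces to edges, so it suffices
  to compare pairs of forward arrows.\<close>

lemma restriction_forward_eq_coherent:
  fixes \<Delta> :: "'n::{finite,linorder} arrow set set"
  assumes perm: "permissible \<Delta>" and uni: "uniform_flag_complex \<Delta>"
    and THTH: "THTH_pairs_do_not_nest \<Delta>"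
  obtains c where "restriction \<Delta> forward_arrows = {\<sigma>. coherent c \<sigma>}"
proof -
  obtain c where c: "\<And>p q r s. p < q \<Longrightarrow> q < r \<Longrightarrow> r < s \<Longrightarrow>
    ({(p, s), (q, r)} \<in> \<Delta> \<longleftrightarrow> \<not> c) \<and> ({(p, r), (q, s)} \<in> \<Delta> \<longleftrightarrow> c)"
    using TTHH_edges[OF perm uni] by blast
  have complex: "simplicial_complex_on arrows \<Delta>" and adm: "\<forall>\<sigma>\<in>\<Delta>. admissible \<sigma>"
    using perm by (auto simp: permissible_def)
  have "coherent c \<sigma>" if \<sigma>: "\<sigma> \<in> \<Delta>" "\<sigma> \<subseteq> forward_arrows" for \<sigma>
    unfolding coherent_def
  proof (intro conjI ballI \<sigma>(2))
    fix a b assume ab: "a \<in> \<sigma>" "b \<in> \<sigma>"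
    obtain I J where "I \<inter> J = {}" "\<sigma> \<subseteq> I \<times> J" using adm \<sigma>(1) by (auto simp: admissible_def)
    then have "a \<in> I \<times> J" "b \<in> I \<times> J" using ab by blast+
    with \<open>I \<inter> J = {}\<close> show "fst a \<noteq> snd b" by (auto simp: mem_Times_iff)
    have "{a, b} \<subseteq> \<sigma>" using ab by simp
    then have "{a, b} \<in> \<Delta>" using complex \<sigma>(1) unfolding simplicial_complex_on_def by metis
    moreover obtain i j k l where "a = (i, j)" "b = (k, l)" by fastforce
    moreover from this have "i < j" "k < l" using ab \<sigma>(2) by (auto simp: forward_arrows_def)
    ultimately show "\<not> conflict c a b" using c[of i k l j] c[of i k j l]
      by (auto simp: conflict_def split: if_splits)
  qed
  moreover have "\<sigma> \<in> \<Delta>" if \<sigma>: "coherent c \<sigma>" for \<sigma>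
  proof -
    have edge: "{a, b} \<in> \<Delta>" if "a \<in> \<sigma>" "b \<in> \<sigma>" "fst a < fst b" "snd a \<noteq> snd b" for a b
    proof -
      obtain i j k l where ab: "a = (i, j)" "b = (k, l)" by fastforce
      have "i < j" "k < l" "i \<noteq> l" "k \<noteq> j" "\<not> conflict c a b"
        using \<sigma> that ab unfolding coherent_def by (force simp: forward_arrows_def)+
      then show ?thesis
        \<comment> \<open>If \<open>j < k\<close> the pair has type THTH and is disjoint as
          intervals. If \<open>k < j\<close> it has type TTHH, nesting when \<open>l < j\<close> and
          crossing otherwise; the absence of a conflict selects the kind that is an edge.\<close>
        using that ab c[of i k l j] c[of i k j l] THTH_edge[OF perm THTH, of i j k l]
        by (cases "k < j"; cases "l < j") (auto simp: conflict_def split: if_splits)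
    qed
    have "{a, b} \<in> \<Delta>" if ab: "a \<in> \<sigma>" "b \<in> \<sigma>" for a b
    proof -
      obtain i j k l where eq: "a = (i, j)" "b = (k, l)" by fastforce
      have less: "i < j" "k < l" "i \<noteq> l" "k \<noteq> j"
        using \<sigma> ab eq unfolding coherent_def by (force simp: forward_arrows_def)+
      \<comment> \<open>Arrows with a common tail or a common head are joined by permissibility; the
        rest is \<open>edge\<close>, up to the order of the two arrows.\<close>
      consider "a = b" | "i = k" "j \<noteq> l" | "j = l" "i \<noteq> k" | "i < k" "j \<noteq> l" | "k < i" "j \<noteq> l"
        using eq by force
      then show ?thesis
      proof cases
        case 1
        then show ?thesis using complex less eq unfolding simplicial_complex_on_def arrows_def by auto
      next
        case 2
        then show ?thesis using perm less eq unfolding permissible_def by auto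
      next
        case 3
        then show ?thesis using perm less eq unfolding permissible_def by auto
      next
        case 4
        then show ?thesis using edge[OF ab] eq by simp
      next
        case 5
        then show ?thesis using edge[OF ab(2,1)] eq by (simp add: insert_commute)
      qed
    qed
    moreover have "flag_on arrows \<Delta>" using uni unfolding uniform_flag_complex_def by blast
    ultimately show "\<sigma> \<in> \<Delta>"
      using coherent_subset_arrows[OF \<sigma>] unfolding flag_on_def by (metis finite)
  qed
  moreover have "\<sigma> \<subseteq> forward_arrows" if "coherent c \<sigma>" for \<sigma>
    using that by (simp add: coherent_def)
  ultimately have "restriction \<Delta> forward_arrows = {\<sigma>. coherent c \<sigma>}"
    unfolding restriction_def by blast
  then show thesis by (rule that)
qed

theorem theorem3p8:
  fixes \<Delta> :: "('n::{finite,linorder}) arrow set set"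
  assumes "permissible \<Delta>"
    and "uniform_flag_complex \<Delta>"
    and "THTH_pairs_do_not_nest \<Delta>"
  shows "represents_triangulation_of (restriction \<Delta> forward_arrows)
           (\<Union>{F. F facet_of positive_root_polytope \<and> 0 \<notin> F})"
proof -
  obtain c where c: "restriction \<Delta> forward_arrows = {\<sigma>. coherent c \<sigma>}"
    using restriction_forward_eq_coherent[OF assms] by blast
  have "inj_on arrow_point (\<Union>{\<sigma> :: 'n arrow set. coherent c \<sigma>})"
    by (rule inj_on_subset[OF inj_on_arrow_point]) (use coherent_subset_arrows in blast)
  then show ?thesis
    unfolding represents_triangulation_of_def c
    by (simp add: coherent_affine_independent coherent_simplicial_complex coherent_simplices_cover)
qed

end
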